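(* Let $f$ be holomorphic on $\Delta^+$ and $\mathcal{C}^\infty$-smooth on $\overline{\Delta^+}$, i.e. $f\in \mathrm{Hol}(\Delta^+)\cap \mathcal{C}^\infty(\overline{\Delta^+})$, and suppose that $f((-1,1))\subset \Gamma_\infty:=\big(\mathbb C\setminus i\mathbb R\big)\cup \{0\}$. Suppose also that the set of zeros of $f|_{(-1,1)}$ is discrete and its limit point is $0$. If $f$ vanishes to infinite order at $0$, then $f\equiv 0$.
   Context: $\Delta^+:=\{z\in \mathbb C : |z|<1,\ \mathrm{Im}(z)>0\}$ is the upper half disc; $(-1,1)\subset\partial\Delta^+$ is its diameter. For a domain $\Omega$ with $a\in\partial\Omega$, a continuous function $f:\overline\Omega\to\mathbb C$ vanishes to infinite order at $a$ if for every $N\in\mathbb N$ one has $\lim_{\Omega\ni x\to a} f(x)/|x-a|^N=0$. "The set of zeros of $f|_{(-1,1)}$ is discrete and its limit point is $0$" means that every zero of $f|_{(-1,1)}$ in $(-1,1)\setminus\{0\}$ is isolated in the set of zeros and that the zero set has no limit point in $(-1,1)$ other than possibly $0$ (the origin may or may not be an isolated zero). *)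

theory Defs
  imports "HOL-Complex_Analysis.Complex_Analysis"
begin

definition upper_half_disc :: "complex set" where
  "upper_half_disc = {z. cmod z < 1 \<and> Im z > 0}"

definition half_disc_diameter :: "complex set" where
  "half_disc_diameter = complex_of_real ` {-1<..<1}"

definition Gamma_infty :: "complex set" where
  "Gamma_infty = (UNIV - range (\<lambda>t::real. \<i> * complex_of_real t)) \<union> {0}"

text \<open>
  \<open>Ck_up_to_boundary k \<Omega> f\<close>, for open \<open>\<Omega>\<close>: all real partial derivatives of \<open>f\<close> of order at most
  \<open>k\<close> exist on \<open>\<Omega>\<close> and each of them has a continuous extension to the closure of \<open>\<Omega>\<close>.
  Values of \<open>f\<close> outside \<open>\<Omega>\<close> are irrelevant here.
\<close>

fun Ck_up_to_boundary ::
  "nat \<Rightarrow> 'a::euclidean_space set \<Rightarrow> ('a \<Rightarrow> 'b::real_normed_vector) \<Rightarrow> bool" where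
  "Ck_up_to_boundary 0 \<Omega> f \<longleftrightarrow>
     (\<exists>g. continuous_on (closure \<Omega>) g \<and> (\<forall>x\<in>\<Omega>. g x = f x))"
| "Ck_up_to_boundary (Suc k) \<Omega> f \<longleftrightarrow>
     (\<exists>g. continuous_on (closure \<Omega>) g \<and> (\<forall>x\<in>\<Omega>. g x = f x)) \<and>
     f differentiable_on \<Omega> \<and>
     (\<forall>b\<in>Basis. Ck_up_to_boundary k \<Omega> (\<lambda>x. frechet_derivative f (at x) b))"

text \<open>
  The space $C^\infty(\overline\Omega)$. The continuity clause makes the values of \<open>f\<close> on the
  boundary those of the continuous extension.
\<close>

definition smooth_on_closure ::
  "'a::euclidean_space set \<Rightarrow> ('a \<Rightarrow> 'b::real_normed_vector) \<Rightarrow> bool" where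
  "smooth_on_closure \<Omega> f \<longleftrightarrow>
     continuous_on (closure \<Omega>) f \<and> (\<forall>k. Ck_up_to_boundary k \<Omega> f)"

definition vanishes_to_infinite_order ::
  "complex set \<Rightarrow> (complex \<Rightarrow> complex) \<Rightarrow> complex \<Rightarrow> bool" where
  "vanishes_to_infinite_order \<Omega> f a \<longleftrightarrow>
     (\<forall>N::nat. ((\<lambda>x. f x / complex_of_real (cmod (x - a) ^ N)) \<longlongrightarrow> 0) (at a within \<Omega>))"

definition diameter_zeros :: "(complex \<Rightarrow> complex) \<Rightarrow> complex set" where
  "diameter_zeros f = {z \<in> half_disc_diameter. f z = 0}"

text \<open>The point \<open>0\<close> may, but need not, be a limit point of the zero set.\<close>

definition zeros_discrete_away_from_0 :: "(complex \<Rightarrow> complex) \<Rightarrow> bool" where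
  "zeros_discrete_away_from_0 f \<longleftrightarrow>
     (\<forall>z \<in> diameter_zeros f - {0}. z isolated_in diameter_zeros f) \<and>
     (\<forall>z \<in> half_disc_diameter. z islimpt diameter_zeros f \<longrightarrow> z = 0)"

end

theory Submission
  imports Defs
begin

text \<open>
  The hypotheses contradict each other, because the zeros on the diameter are discrete away from
  \<open>0\<close> and hence \<open>f\<close> is nonzero at some point \<open>p\<close> of the diameter. Write
  \<open>u = Re f\<close> there; the values of \<open>f\<close> on the diameter lie in \<open>Gamma_infty\<close>, so \<open>u\<close> vanishes
  only where \<open>f\<close> does.

  Suppose first that \<open>u \<ge> 0\<close> on \<open>[-r, r]\<close>. By Cauchy's theorem on the rectangle with base
  \<open>[-r, r]\<close> and height \<open>r\<close>, the integral of \<open>f(t) / t^n\<close> over the base is \<open>O(r^(-n))\<close>: all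
  points of the other three sides have modulus at least \<open>r\<close>, and the infinite order of vanishing
  removes the pole. For even \<open>n\<close> the real part of the integrand is nonnegative, so the integral
  of \<open>u(t) (r / t)^n\<close> stays bounded as \<open>n\<close> grows, which forces \<open>u = 0\<close> on \<open>(-r, r)\<close>.

  In general \<open>u\<close> changes sign, possibly infinitely often near \<open>0\<close>. Only the finitely many sign
  changes \<open>c\<close> with \<open>\<bar>c\<bar> > \<delta>\<close> are corrected: \<open>f\<close> is multiplied by the product of the
  alternating quotients
  \<open>(z - c\<^sub>1) / (z - c\<^sub>2) * (z - c\<^sub>3) / (z - c\<^sub>4) * \<dots>\<close> over \<open>c\<^sub>1 < c\<^sub>2 < \<dots>\<close> to the right of
  \<open>\<delta>\<close>, and of its mirror image for the sign changes to the left of \<open>-\<delta>\<close>. These factors are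
  real on the diameter, and on each of \<open>(\<delta>, r)\<close> and \<open>(-r, -\<delta>)\<close> their product has the sign of \<open>u\<close> up
  to a constant; the parity of \<open>n\<close> is chosen so as to make the two constants agree in
  \<open>f(z) / z^n\<close>. Three properties make them usable:

  \<^item> at a distance \<open>\<ge> \<theta>\<close> from all \<open>c\<close> the quotient is bounded above and away from \<open>0\<close> by constants
    that depend on \<open>\<theta>\<close> only, and not on the number of factors, because the intervals
    \<open>[c\<^sub>1, c\<^sub>2], [c\<^sub>3, c\<^sub>4], \<dots>\<close> are disjoint (\<open>norm_alt_quot_le\<close>, \<open>norm_alt_quot_ge\<close>);
  \<^item> to the left of \<open>c\<^sub>1\<close>, in particular on \<open>[-\<delta>, \<delta>]\<close>, each quotient is at most \<open>1\<close> in modulus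
    and an unpaired last factor is at most \<open>2\<close> (\<open>abs_alt_quot_le\<close>);
  \<^item> the poles are simple and lie at zeros of the Lipschitz function \<open>f\<close>, so the product with \<open>f\<close>
    is bounded and the base of the rectangle may be pushed to the real axis by dominated
    convergence (\<open>rectangle_estimate\<close>).

  On \<open>[-\<delta>, \<delta>]\<close> the sign of the integrand is unknown, but its modulus is at most \<open>4 C n\<close>, where
  \<open>\<bar>f z\<bar> \<le> C n * \<bar>z\<bar>^n\<close>. Hence this part of the integral tends to \<open>0\<close> with \<open>\<delta>\<close>
  (\<open>moment_estimate\<close>). Letting first \<open>\<delta>\<close> tend to \<open>0\<close> and then \<open>n\<close> to infinity contradicts
  \<open>u(p) \<noteq> 0\<close> for \<open>0 < p < r\<close>.
\<close>

section \<open>Alternating quotients\<close>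

text \<open>
  For a list \<open>[c\<^sub>1, c\<^sub>2, c\<^sub>3, \<dots>]\<close> of real numbers this is the rational function
  \<open>(z - c\<^sub>1) / (z - c\<^sub>2) * (z - c\<^sub>3) / (z - c\<^sub>4) * \<dots>\<close>. In a list of odd length the last entry
  contributes the unpaired factor \<open>z - c\<close>, so the first entry is always a zero and never a pole.
\<close>

fun alt_quot :: "real list \<Rightarrow> 'a::real_normed_field \<Rightarrow> 'a" where
  "alt_quot [] z = 1"
| "alt_quot [c] z = z - of_real c"
| "alt_quot (c # d # cs) z = (z - of_real c) / (z - of_real d) * alt_quot cs z"

lemma alt_quot_of_real: "alt_quot cs (of_real t) = of_real (alt_quot cs t)"
  by (induction cs t rule: alt_quot.induct) auto

lemma sgn_alt_quot: "sgn (alt_quot cs t) = (\<Prod>c\<leftarrow>cs. sgn (t - c))" for t :: real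
proof (induction cs t rule: alt_quot.induct)
  case (3 c d cs t)
  have "inverse (sgn (t - d)) = sgn (t - d)"
    by (simp add: sgn_real_def)
  then show ?case using 3 by (simp add: sgn_mult divide_inverse)
qed simp_all

lemma holomorphic_on_alt_quot [holomorphic_intros]:
  "h holomorphic_on S \<Longrightarrow> (\<And>z c. z \<in> S \<Longrightarrow> c \<in> set cs \<Longrightarrow> h z \<noteq> of_real c)
    \<Longrightarrow> (\<lambda>z. alt_quot cs (h z)) holomorphic_on S"
  by (induction cs "0::complex" rule: alt_quot.induct) (auto intro!: holomorphic_intros)

lemma tendsto_alt_quot [tendsto_intros]:
  "(h \<longlongrightarrow> l) F \<Longrightarrow> (\<And>c. c \<in> set cs \<Longrightarrow> l \<noteq> of_real c)
    \<Longrightarrow> ((\<lambda>z. alt_quot cs (h z)) \<longlongrightarrow> alt_quot cs l) F"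
  by (induction cs l rule: alt_quot.induct) (auto intro!: tendsto_intros)

text \<open>
  Exponential bounds are used since the exponents add up to the total length of the intervals
  between paired entries.
\<close>

lemma norm_shift_quotient_le:
  fixes z :: "'a::real_normed_field"
  assumes "0 < \<delta>" "\<delta> \<le> norm (z - of_real d)"
  shows "norm ((z - of_real c) / (z - of_real d)) \<le> exp (\<bar>d - c\<bar> / \<delta>)"
proof -
  have "norm (z - of_real c) = norm ((z - of_real d) + of_real (d - c))" by simp
  also have "\<dots> \<le> norm (z - of_real d) + \<bar>d - c\<bar>"
    by (metis norm_of_real norm_triangle_ineq)
  finally have "norm ((z - of_real c) / (z - of_real d))
      \<le> (norm (z - of_real d) + \<bar>d - c\<bar>) / norm (z - of_real d)"
    by (simp add: norm_divide divide_right_mono)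
  also have "\<dots> = 1 + \<bar>d - c\<bar> / norm (z - of_real d)"
    using assms by (auto simp: add_divide_distrib)
  also have "\<dots> \<le> 1 + \<bar>d - c\<bar> / \<delta>"
    using assms by (intro add_left_mono divide_left_mono mult_pos_pos) auto
  also have "\<dots> \<le> exp (\<bar>d - c\<bar> / \<delta>)" by (rule exp_ge_add_one_self)
  finally show ?thesis .
qed

text \<open>The bounds are independent of the length of the list.\<close>

lemma norm_alt_quot_le:
  fixes z :: "'a::real_normed_field"
  assumes "0 < \<delta>" "1 \<le> R" "a \<le> b" "sorted cs" "set cs \<subseteq> {a..b}"
    and "\<And>c. c \<in> set cs \<Longrightarrow> \<delta> \<le> norm (z - of_real c) \<and> norm (z - of_real c) \<le> R"
  shows "norm (alt_quot cs z) \<le> R * exp ((b - a) / \<delta>)"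
  using assms(3-)
proof (induction cs z arbitrary: a rule: alt_quot.induct)
  case (1 z)
  have "1 * 1 \<le> R * exp ((b - a) / \<delta>)" using 1 assms(1,2) by (intro mult_mono) auto
  then show ?case by simp
next
  case (2 c z)
  have "norm (z - of_real c) * 1 \<le> R * exp ((b - a) / \<delta>)"
    using 2 assms(1,2) by (intro mult_mono) auto
  then show ?case by simp
next
  case (3 c d cs z)
  have "norm (alt_quot (c # d # cs) z)
      \<le> exp (\<bar>d - c\<bar> / \<delta>) * (R * exp ((b - d) / \<delta>))"
    unfolding alt_quot.simps norm_mult
    using 3 assms(1) by (intro mult_mono norm_shift_quotient_le "3.IH") auto
  also have "\<dots> = R * exp ((b - c) / \<delta>)"
    using 3 by (simp add: mult_exp_exp diff_divide_distrib)
  also have "\<dots> \<le> R * exp ((b - a) / \<delta>)"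
    using 3 assms(1,2) by (auto intro!: mult_left_mono divide_right_mono)
  finally show ?case .
qed

lemma norm_alt_quot_ge:
  fixes z :: "'a::real_normed_field"
  assumes "0 < \<delta>" "\<delta> \<le> 1" "a \<le> b" "sorted cs" "set cs \<subseteq> {a..b}"
    and "\<And>c. c \<in> set cs \<Longrightarrow> \<delta> \<le> norm (z - of_real c)"
  shows "\<delta> * exp (- ((b - a) / \<delta>)) \<le> norm (alt_quot cs z)"
  using assms(3-)
proof (induction cs z arbitrary: a rule: alt_quot.induct)
  case (1 z)
  have "\<delta> * exp (- ((b - a) / \<delta>)) \<le> 1 * 1" using 1 assms(1,2) by (intro mult_mono) auto
  then show ?case by simp
next
  case (2 c z)
  have "\<delta> * exp (- ((b - a) / \<delta>)) \<le> norm (z - of_real c) * 1"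
    using 2 assms(1,2) by (intro mult_mono) auto
  then show ?case by simp
next
  case (3 c d cs z)
  have "norm ((z - of_real d) / (z - of_real c)) \<le> exp (\<bar>d - c\<bar> / \<delta>)"
    using norm_shift_quotient_le[of \<delta> z c d] 3 assms(1) by (simp add: abs_minus_commute)
  moreover have "0 < norm ((z - of_real d) / (z - of_real c))"
    using "3.prems"(4)[of c] "3.prems"(4)[of d] assms(1) by auto
  ultimately have "inverse (exp (\<bar>d - c\<bar> / \<delta>)) \<le> inverse (norm ((z - of_real d) / (z - of_real c)))"
    by (rule le_imp_inverse_le)
  then have q: "exp (- (\<bar>d - c\<bar> / \<delta>)) \<le> norm ((z - of_real c) / (z - of_real d))"
    by (simp add: exp_minus norm_divide field_simps)
  have "\<delta> * exp (- ((b - a) / \<delta>)) \<le> \<delta> * exp (- ((b - c) / \<delta>))"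
    using 3 assms(1,2) by (auto intro!: mult_left_mono divide_right_mono)
  also have "\<dots> = exp (- (\<bar>d - c\<bar> / \<delta>)) * (\<delta> * exp (- ((b - d) / \<delta>)))"
    using 3 by (simp add: mult_exp_exp diff_divide_distrib)
  also have "\<dots> \<le> norm (alt_quot (c # d # cs) z)"
    unfolding alt_quot.simps norm_mult
    using 3 assms(1) q by (intro mult_mono "3.IH") auto
  finally show ?case .
qed

text \<open>
  To the left of all entries every quotient \<open>(c - t) / (d - t)\<close> with \<open>c \<le> d\<close> is at most \<open>1\<close>; no
  distance from the poles is needed.
\<close>

lemma abs_alt_quot_le:
  fixes t :: real
  assumes "1 \<le> R" "sorted cs" "\<And>c. c \<in> set cs \<Longrightarrow> t \<le> c \<and> c - t \<le> R"
  shows "\<bar>alt_quot cs t\<bar> \<le> R"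
  using assms(2,3)
proof (induction cs t rule: alt_quot.induct)
  case (3 c d cs t)
  have "\<bar>t - c\<bar> \<le> \<bar>t - d\<bar>" using 3 by auto
  then have "\<bar>(t - c) / (t - d)\<bar> \<le> 1"
    by (cases "t = d") (auto simp: abs_divide field_simps)
  moreover have "\<bar>alt_quot cs t\<bar> \<le> R" using 3 by auto
  ultimately have "\<bar>(t - c) / (t - d)\<bar> * \<bar>alt_quot cs t\<bar> \<le> 1 * R"
    by (intro mult_mono) auto
  then show ?case by (simp add: abs_mult)
qed (use assms(1) in auto)

text \<open>Multiplication by the product of the distances to the entries removes all poles.\<close>

lemma norm_alt_quot_times_prod_le:
  fixes z :: "'a::real_normed_field"
  assumes "1 \<le> R" "\<And>c. c \<in> set cs \<Longrightarrow> norm (z - of_real c) \<le> R"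
  shows "norm (alt_quot cs z) * (\<Prod>c\<leftarrow>cs. norm (z - of_real c)) \<le> R ^ (2 * length cs)"
  using assms(2)
proof (induction cs z rule: alt_quot.induct)
  case (2 c z)
  have "norm (z - of_real c) * norm (z - of_real c) \<le> R * R"
    using 2 assms(1) by (intro mult_mono) auto
  then show ?case by (simp add: power2_eq_square)
next
  case (3 c d cs z)
  let ?P = "norm (alt_quot cs z) * (\<Prod>c\<leftarrow>cs. norm (z - of_real c))"
  have P: "0 \<le> ?P" by (intro mult_nonneg_nonneg prod_list_nonneg) auto
  have "norm (alt_quot (c # d # cs) z) * (\<Prod>c\<leftarrow>c # d # cs. norm (z - of_real c))
      = (norm (z - of_real c) * norm (z - of_real c)) * ?P * (if z = of_real d then 0 else 1)"
    by (simp add: norm_mult norm_divide)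
  also have "\<dots> \<le> (norm (z - of_real c) * norm (z - of_real c)) * ?P"
    by (intro mult_left_le mult_nonneg_nonneg P) auto
  also have "\<dots> \<le> (R * R) * R ^ (2 * length cs)"
    using 3 assms(1) by (intro mult_mono mult_nonneg_nonneg P) auto
  also have "\<dots> \<le> (R * R) * R ^ (2 * length cs) * (R * R)"
    using assms(1) mult_mono[of 1 R 1 R] mult_left_mono[of 1 "R * R" "(R * R) * R ^ (2 * length cs)"]
    by simp
  finally show ?case by (simp add: algebra_simps)
qed auto

section \<open>Sign changes of a real function with finitely many zeros\<close>

lemma constant_sign:
  fixes u :: "real \<Rightarrow> real"
  assumes "continuous_on {a<..<b} u" "\<And>t. t \<in> {a<..<b} \<Longrightarrow> u t \<noteq> 0"
  shows "\<exists>s\<in>{-1,1}. \<forall>t\<in>{a<..<b}. sgn (u t) = s"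
proof -
  have "connected (u ` {a<..<b})"
    using assms(1) by (intro connected_continuous_image) auto
  moreover have "0 \<notin> u ` {a<..<b}" using assms(2) by force
  ultimately have "(\<forall>t\<in>{a<..<b}. 0 < u t) \<or> (\<forall>t\<in>{a<..<b}. u t < 0)"
    unfolding connected_iff_interval
    by (smt (verit, best) imageE image_eqI)
  then show ?thesis by auto
qed

text \<open>
  The set \<open>S\<close> consists of the zeros at which \<open>u\<close> changes sign. The induction removes the largest
  zero \<open>m\<close>, which belongs to \<open>S\<close> iff the signs on both sides of it differ; in that case the
  constant \<open>s\<close> changes as well, because the new factor \<open>sgn (t - m)\<close> is negative to the left of \<open>m\<close>.
\<close>

lemma sign_changes:
  fixes u :: "real \<Rightarrow> real"
  assumes "continuous_on {a<..<b} u" "finite {t \<in> {a<..<b}. u t = 0}"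
  shows "\<exists>S s. finite S \<and> S \<subseteq> {t \<in> {a<..<b}. u t = 0} \<and> s \<in> {-1, 1} \<and>
    (\<forall>t\<in>{a<..<b}. u t \<noteq> 0 \<longrightarrow> sgn (u t) = s * (\<Prod>c\<in>S. sgn (t - c)))"
  using assms
proof (induction "card {t \<in> {a<..<b}. u t = 0}" arbitrary: b)
  case 0
  then have "u t \<noteq> 0" if "t \<in> {a<..<b}" for t using that by auto
  then have "\<exists>s\<in>{-1,1}. \<forall>t\<in>{a<..<b}. sgn (u t) = s"
    using 0 constant_sign by blast
  then show ?case by (intro exI[of _ "{}"]) auto
next
  case (Suc n)
  define Z where "Z = {t \<in> {a<..<b}. u t = 0}"
  have Z: "finite Z" "Z \<noteq> {}" "card Z = Suc n"
    using Suc.prems(2) Suc.hyps(2) card_gt_0_iff[of Z] unfolding Z_def by simp_all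
  define m where "m = Max Z"
  have m: "m \<in> Z" "\<And>t. t \<in> Z \<Longrightarrow> t \<le> m" using Z by (auto simp: m_def)
  have Z': "{t \<in> {a<..<m}. u t = 0} = Z - {m}"
    using m by (force simp: Z_def)
  have "n = card {t \<in> {a<..<m}. u t = 0}" "finite {t \<in> {a<..<m}. u t = 0}"
    unfolding Z' using Z m by auto
  moreover have "continuous_on {a<..<m} u"
    using Suc.prems(1) by (rule continuous_on_subset) (use m in \<open>auto simp: Z_def\<close>)
  ultimately obtain S s where S: "finite S" "S \<subseteq> Z - {m}" "s \<in> {-1, 1}"
    "\<forall>t\<in>{a<..<m}. u t \<noteq> 0 \<longrightarrow> sgn (u t) = s * (\<Prod>c\<in>S. sgn (t - c))"
    using Suc.hyps(1)[of m] unfolding Z' by blast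
  have Sm: "c < m" if "c \<in> S" for c using S(2) m that by force
  have P1: "(\<Prod>c\<in>S. sgn (t - c)) = 1" if "m < t" for t
    using Sm that by (intro prod.neutral) fastforce
  have "\<exists>s\<in>{-1,1}. \<forall>t\<in>{m<..<b}. sgn (u t) = s"
  proof (rule constant_sign)
    show "continuous_on {m<..<b} u"
      using Suc.prems(1) by (rule continuous_on_subset) (use m in \<open>auto simp: Z_def\<close>)
    show "u t \<noteq> 0" if "t \<in> {m<..<b}" for t
      using m(1) m(2)[of t] that by (force simp: Z_def)
  qed
  then obtain s' where s': "s' \<in> {-1,1}" "\<forall>t\<in>{m<..<b}. sgn (u t) = s'" by blast
  have um: "u m = 0" using m by (simp add: Z_def)
  show ?case
  proof (cases "s' = s")
    case True
    show ?thesis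
    proof (intro exI[of _ S] exI[of _ s] conjI ballI impI)
      show "S \<subseteq> {t \<in> {a<..<b}. u t = 0}" using S(2) by (auto simp: Z_def)
      show "sgn (u t) = s * (\<Prod>c\<in>S. sgn (t - c))" if "t \<in> {a<..<b}" "u t \<noteq> 0" for t
        using that S(4) s' True P1[of t] um by (cases t m rule: linorder_cases) auto
    qed (use S in auto)
  next
    case False
    then have s's: "s' = - s" using s'(1) S(3) by auto
    have mS: "m \<notin> S" using Sm by blast
    show ?thesis
    proof (intro exI[of _ "insert m S"] exI[of _ "s'"] conjI ballI impI)
      show "insert m S \<subseteq> {t \<in> {a<..<b}. u t = 0}" using S(2) m by (auto simp: Z_def)
      show "sgn (u t) = s' * (\<Prod>c\<in>insert m S. sgn (t - c))" if "t \<in> {a<..<b}" "u t \<noteq> 0" for t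
        using that S(1,4) s' s's P1[of t] um mS by (cases t m rule: linorder_cases) auto
    qed (use S s' in auto)
  qed
qed

lemma sign_changes_list:
  fixes u :: "real \<Rightarrow> real"
  assumes "continuous_on {a<..<b} u" "finite {t \<in> {a<..<b}. u t = 0}"
  obtains cs s where "sorted cs" "distinct cs" "set cs \<subseteq> {t \<in> {a<..<b}. u t = 0}" "\<bar>s\<bar> = 1"
    "\<And>t. t \<in> {a<..<b} \<Longrightarrow> u t \<noteq> 0 \<Longrightarrow> sgn (u t) = s * sgn (alt_quot cs t)"
proof -
  obtain S s where S: "finite S" "S \<subseteq> {t \<in> {a<..<b}. u t = 0}" "s \<in> {-1, 1}"
    "\<forall>t\<in>{a<..<b}. u t \<noteq> 0 \<longrightarrow> sgn (u t) = s * (\<Prod>c\<in>S. sgn (t - c))"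
    using sign_changes[OF assms] by blast
  show ?thesis
  proof (rule that[of "sorted_list_of_set S" s])
    show "sgn (u t) = s * sgn (alt_quot (sorted_list_of_set S) t)"
      if "t \<in> {a<..<b}" "u t \<noteq> 0" for t
      using S that by (simp add: sgn_alt_quot flip: prod.distinct_set_conv_list)
  qed (use S in auto)
qed

section \<open>The half disc\<close>

lemma upper_half_disc_altdef: "upper_half_disc = ball 0 1 \<inter> {z. 0 < Im z}"
  by (auto simp: upper_half_disc_def)

lemma open_upper_half_disc: "open upper_half_disc"
  unfolding upper_half_disc_altdef by (intro open_Int open_ball open_halfspace_Im_gt)

lemma convex_upper_half_disc: "convex upper_half_disc"
  unfolding upper_half_disc_altdef by (intro convex_Int convex_ball convex_halfspace_Im_gt)

lemma compact_closure_upper_half_disc: "compact (closure upper_half_disc)"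
proof -
  have "bounded upper_half_disc"
    unfolding upper_half_disc_altdef by (intro bounded_Int disjI1 bounded_ball)
  then show ?thesis by (simp add: compact_closure)
qed

lemma diameter_subset_closure: "half_disc_diameter \<subseteq> closure upper_half_disc"
proof
  fix z assume "z \<in> half_disc_diameter"
  then obtain t where t: "z = of_real t" "-1 < t" "t < 1" by (auto simp: half_disc_diameter_def)
  have lim: "((\<lambda>e. of_real t + \<i> * of_real e) \<longlongrightarrow> of_real t + \<i> * of_real 0) (at_right (0::real))"
    by (intro tendsto_intros)
  have "\<forall>\<^sub>F e in at_right (0::real). cmod (of_real t + \<i> * of_real e) < 1"
    by (rule order_tendstoD(2)[OF tendsto_norm[OF lim]]) (use t in auto)
  then have "\<forall>\<^sub>F e in at_right (0::real). of_real t + \<i> * of_real e \<in> closure upper_half_disc"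
    using eventually_at_right_less[of 0]
    by eventually_elim (use closure_subset in \<open>force simp: upper_half_disc_def\<close>)
  from Lim_in_closed_set[OF closed_closure this _ lim] show "z \<in> closure upper_half_disc"
    by (simp add: t)
qed

section \<open>Cauchy's theorem on a rectangle standing on the diameter\<close>

text \<open>
  \<open>M\<close> bounds \<open>\<Phi>\<close> on the three sides away from the real axis, of total length \<open>4 r\<close>. The bound \<open>K\<close>,
  which does not enter the conclusion, justifies moving the base to the real axis; there \<open>\<Phi>\<close> need
  not extend continuously to the finitely many points of \<open>Z\<close>.
\<close>

lemma rectangle_estimate:
  assumes hol: "\<Phi> holomorphic_on upper_half_disc"
    and r: "0 < r" "r < 1/2" and "finite Z"
    and K: "\<And>z. z \<in> upper_half_disc \<Longrightarrow> norm (\<Phi> z) \<le> K"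
    and M: "\<And>z. z \<in> upper_half_disc \<Longrightarrow> \<bar>Re z\<bar> = r \<or> Im z = r \<Longrightarrow> norm (\<Phi> z) \<le> M"
    and lim: "\<And>t. t \<in> {-r..r} - Z \<Longrightarrow> (\<Phi> \<longlongrightarrow> \<Phi> (of_real t)) (at (of_real t) within upper_half_disc)"
  shows "(\<lambda>t. \<Phi> (of_real t)) integrable_on {-r..r}"
    and "norm (integral {-r..r} (\<lambda>t. \<Phi> (of_real t))) \<le> 4 * r * M"
proof -
  define \<epsilon> where "\<epsilon> k = r / real (k + 2)" for k
  have \<epsilon>: "0 < \<epsilon> k" "\<epsilon> k < r" for k
    using r by (auto simp: \<epsilon>_def field_simps add_pos_nonneg)
  have \<epsilon>0: "\<epsilon> \<longlonglongrightarrow> 0"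
    unfolding \<epsilon>_def by real_asymp
  have inD: "z \<in> upper_half_disc" if "\<bar>Re z\<bar> \<le> r" "0 < Im z" "Im z \<le> r" for z
    using cmod_le[of z] that r by (simp add: upper_half_disc_def)
  have "norm (\<Phi> (Complex r r)) \<le> M" using r by (intro M inD) auto
  then have M0: "0 \<le> M" using norm_ge_zero order_trans by blast
  \<comment> \<open>For each \<open>k\<close>, Cauchy's theorem on the rectangle \<open>[-r, r] \<times> [\<epsilon> k, r]\<close>.\<close>
  have bottom: "((\<lambda>t. \<Phi> (of_real t + \<i> * \<epsilon> k)) integrable_on {-r..r}) \<and>
      norm (integral {-r..r} (\<lambda>t. \<Phi> (of_real t + \<i> * \<epsilon> k))) \<le> 4 * r * M" for k
  proof -
    define a1 a2 a3 a4 where a: "a1 = Complex (-r) (\<epsilon> k)" "a2 = Complex r (\<epsilon> k)"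
      "a3 = Complex r r" "a4 = Complex (-r) r"
    have seg: "z \<in> upper_half_disc \<and> (\<bar>Re z\<bar> = r \<or> Im z = r)"
      if "z \<in> closed_segment a2 a3 \<or> z \<in> closed_segment a3 a4 \<or> z \<in> closed_segment a4 a1" for z
      using that \<epsilon>[of k] r
      by (auto intro!: inD simp: a closed_segment_same_Re closed_segment_same_Im closed_segment_eq_real_ivl)
    have seg1: "closed_segment a1 a2 \<subseteq> upper_half_disc"
      using \<epsilon>[of k] r
      by (auto intro!: inD simp: a closed_segment_same_Im closed_segment_eq_real_ivl)
    have int: "\<Phi> contour_integrable_on linepath p q" if "closed_segment p q \<subseteq> upper_half_disc" for p q
      using that by (intro contour_integrable_continuous_linepath
          continuous_on_subset[OF holomorphic_on_imp_continuous_on[OF hol]]) auto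
    have ints: "\<Phi> contour_integrable_on linepath a1 a2" "\<Phi> contour_integrable_on linepath a2 a3"
      "\<Phi> contour_integrable_on linepath a3 a4" "\<Phi> contour_integrable_on linepath a4 a1"
      using seg seg1 by (auto intro!: int)
    have "(\<Phi> has_contour_integral 0) (linepath a1 a2 +++ linepath a2 a3 +++ linepath a3 a4 +++ linepath a4 a1)"
      by (rule Cauchy_theorem_convex_simple[OF hol convex_upper_half_disc])
         (use seg seg1 in \<open>auto simp: path_image_join\<close>)
    then have "contour_integral (linepath a1 a2) \<Phi> + (contour_integral (linepath a2 a3) \<Phi> +
        (contour_integral (linepath a3 a4) \<Phi> + contour_integral (linepath a4 a1) \<Phi>)) = 0"
      using ints by (auto dest!: contour_integral_unique)
    then have "contour_integral (linepath a1 a2) \<Phi> = - (contour_integral (linepath a2 a3) \<Phi> +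
        (contour_integral (linepath a3 a4) \<Phi> + contour_integral (linepath a4 a1) \<Phi>))"
      by (rule iffD2[OF eq_neg_iff_add_eq_0])
    then have "norm (contour_integral (linepath a1 a2) \<Phi>) \<le> norm (contour_integral (linepath a2 a3) \<Phi>) +
        (norm (contour_integral (linepath a3 a4) \<Phi>) + norm (contour_integral (linepath a4 a1) \<Phi>))"
      by (metis (no_types, opaque_lifting) norm_minus_cancel norm_triangle_mono norm_triangle_ineq order_refl)
    also have "\<dots> \<le> M * norm (a3 - a2) + (M * norm (a4 - a3) + M * norm (a1 - a4))"
      by (intro add_mono contour_integral_bound_linepath ints M0 M) (use seg in blast)+
    also have "\<dots> \<le> M * r + (M * (2 * r) + M * r)"
      using \<epsilon>[of k] r M0 cmod_le[of "a3 - a2"] cmod_le[of "a4 - a3"] cmod_le[of "a1 - a4"]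
      by (intro add_mono mult_left_mono) (simp_all add: a)
    finally have le: "norm (contour_integral (linepath a1 a2) \<Phi>) \<le> 4 * r * M"
      by (simp add: algebra_simps)
    have "(\<Phi> has_contour_integral contour_integral (linepath a1 a2) \<Phi>) (linepath a1 a2)"
      using ints has_contour_integral_integral by blast
    then have "((\<lambda>z. \<Phi> (z + \<i> * \<epsilon> k)) has_contour_integral contour_integral (linepath a1 a2) \<Phi>)
        (linepath (of_real (-r)) (of_real r))"
      unfolding has_contour_integral_linepath
      by (simp add: a linepath_def Complex_eq scaleR_conv_of_real algebra_simps)
    then have "((\<lambda>t. \<Phi> (of_real t + \<i> * \<epsilon> k)) has_integral contour_integral (linepath a1 a2) \<Phi>) {-r..r}"
      using r by (subst (asm) has_contour_integral_linepath_Reals_iff) auto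
    then show ?thesis using le by (auto simp: integral_unique has_integral_integrable)
  qed
  define S where "S = {-r..r} - Z"
  have neg: "negligible (({-r..r} - S) \<union> (S - {-r..r}))" "negligible ({-r..r} - S)"
    using \<open>finite Z\<close> by (auto intro!: negligible_finite elim: finite_subset[rotated] simp: S_def)
  have on_S: "g integrable_on S \<longleftrightarrow> g integrable_on {-r..r}" "integral S g = integral {-r..r} g"
    for g :: "real \<Rightarrow> complex"
  proof -
    show "g integrable_on S \<longleftrightarrow> g integrable_on {-r..r}"
      by (rule sym[OF integrable_spike_set_eq[OF neg(1)]])
    show "integral S g = integral {-r..r} g"
    proof (rule integral_spike_set)
      show "negligible {x \<in> S - {-r..r}. g x \<noteq> 0}" by (rule negligible_subset[OF negligible_empty]) (auto simp: S_def)
      show "negligible {x \<in> {-r..r} - S. g x \<noteq> 0}" by (rule negligible_subset[OF neg(2)]) blast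
    qed
  qed
  have hS: "(\<lambda>_. K) integrable_on S"
    unfolding integrable_spike_set_eq[OF neg(1), symmetric] by (rule integrable_const_ivl)
  note dc = dominated_convergence[of "\<lambda>k t. \<Phi> (of_real t + \<i> * \<epsilon> k)" S "\<lambda>_. K" "\<lambda>t. \<Phi> (of_real t)"]
  have b: "norm (\<Phi> (of_real t + \<i> * \<epsilon> k)) \<le> K" if "t \<in> S" for t k
    using that \<epsilon>[of k] r by (intro K inD) (auto simp: S_def)
  have l: "(\<lambda>k. \<Phi> (of_real t + \<i> * \<epsilon> k)) \<longlonglongrightarrow> \<Phi> (of_real t)" if "t \<in> S" for t
  proof (rule filterlim_compose[OF lim])
    have "(\<lambda>k. complex_of_real t + \<i> * of_real (\<epsilon> k)) \<longlonglongrightarrow> of_real t + \<i> * of_real 0"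
      by (intro tendsto_intros \<epsilon>0)
    moreover have "complex_of_real t + \<i> * of_real (\<epsilon> k) \<in> upper_half_disc" for k
      using that \<epsilon>[of k] r by (intro inD) (auto simp: S_def)
    moreover have "complex_of_real t + \<i> * of_real (\<epsilon> k) \<noteq> of_real t" for k
      using \<epsilon>(1)[of k] by simp
    ultimately show "filterlim (\<lambda>k. complex_of_real t + \<i> * of_real (\<epsilon> k))
        (at (of_real t) within upper_half_disc) sequentially"
      unfolding filterlim_at by simp
  qed (use that in \<open>auto simp: S_def\<close>)
  show "(\<lambda>t. \<Phi> (of_real t)) integrable_on {-r..r}"
    using dc(1)[OF _ hS b l] bottom by (simp add: on_S)
  have "(\<lambda>k. norm (integral {-r..r} (\<lambda>t. \<Phi> (of_real t + \<i> * \<epsilon> k))))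
      \<longlonglongrightarrow> norm (integral {-r..r} (\<lambda>t. \<Phi> (of_real t)))"
    using dc(2)[OF _ hS b l] bottom by (intro tendsto_norm) (simp add: on_S)
  then show "norm (integral {-r..r} (\<lambda>t. \<Phi> (of_real t))) \<le> 4 * r * M"
    by (rule Lim_bounded) (use bottom in auto)
qed

section \<open>Consequences of smoothness and of vanishing to infinite order\<close>

lemma smooth_imp_Lipschitz:
  assumes hol: "f holomorphic_on upper_half_disc" and sm: "smooth_on_closure upper_half_disc f"
  obtains L where "0 \<le> L"
    "\<And>z w. z \<in> closure upper_half_disc \<Longrightarrow> w \<in> closure upper_half_disc \<Longrightarrow>
      norm (f z - f w) \<le> L * norm (z - w)"
proof -
  let ?D = upper_half_disc
  have "Ck_up_to_boundary (Suc 0) ?D f" using sm by (simp only: smooth_on_closure_def)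
  then obtain g where g: "continuous_on (closure ?D) g"
    "\<And>z. z \<in> ?D \<Longrightarrow> g z = frechet_derivative f (at z) 1"
    by (auto simp: Basis_complex_def)
  have der: "(f has_field_derivative g z) (at z)" if "z \<in> ?D" for z
  proof -
    have "(f has_field_derivative deriv f z) (at z)"
      using hol open_upper_half_disc that by (rule holomorphic_derivI)
    then have "frechet_derivative f (at z) = (*) (deriv f z)"
      using frechet_derivative_at by (metis has_field_derivative_def)
    then show ?thesis using g(2)[OF that] \<open>(f has_field_derivative deriv f z) (at z)\<close> by simp
  qed
  obtain L where L: "0 < L" "\<And>z. z \<in> closure ?D \<Longrightarrow> norm (g z) \<le> L"
    using compact_imp_bounded[OF compact_continuous_image[OF g(1) compact_closure_upper_half_disc]]
    unfolding bounded_pos by auto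
  have "norm (f z - f w) \<le> L * norm (z - w)" if "z \<in> ?D" "w \<in> ?D" for z w
    by (rule field_differentiable_bound[OF convex_upper_half_disc])
       (use der L that closure_subset in \<open>auto intro: has_field_derivative_at_within\<close>)
  then have "L-lipschitz_on ?D f"
    using L by (auto simp: lipschitz_on_def dist_norm)
  then have "L-lipschitz_on (closure ?D) f"
    by (rule lipschitz_on_closure) (use sm in \<open>simp add: smooth_on_closure_def\<close>)
  then show ?thesis using that[of L] L by (auto simp: lipschitz_on_def dist_norm)
qed

lemma bound_on_closure:
  fixes f g :: "complex \<Rightarrow> real"
  assumes "continuous_on (closure D) f" "continuous_on (closure D) g"
    "\<And>z. z \<in> D \<Longrightarrow> f z \<le> g z" "z \<in> closure D"
  shows "f z \<le> g z"
proof -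
  have "continuous_on (closure D) (\<lambda>z. g z - f z)" using assms by (intro continuous_intros)
  from continuous_ge_on_closure[OF this assms(4), of 0] show ?thesis using assms(3) by simp
qed

lemma infinite_order_bound:
  assumes cont: "continuous_on (closure D) f" and "bounded D" "0 \<notin> D"
    and van: "vanishes_to_infinite_order D f 0"
  obtains C where "0 \<le> C" "\<And>z. z \<in> closure D \<Longrightarrow> norm (f z) \<le> C * norm z ^ N"
proof -
  have lim: "((\<lambda>x. f x / complex_of_real (cmod x ^ N)) \<longlongrightarrow> 0) (at 0 within D)"
    using van by (auto simp: vanishes_to_infinite_order_def)
  have "\<forall>\<^sub>F x in at 0 within D. norm (f x / complex_of_real (cmod x ^ N)) < 1"
    by (rule order_tendstoD(2)[OF tendsto_norm[OF lim]]) simp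
  then obtain d where d: "d > 0"
    "\<And>z. z \<in> D \<Longrightarrow> z \<noteq> 0 \<Longrightarrow> norm z < d \<Longrightarrow> norm (f z / complex_of_real (cmod z ^ N)) < 1"
    unfolding eventually_at by (auto simp: dist_norm)
  have "compact (closure D)" using \<open>bounded D\<close> by (simp add: compact_closure)
  then obtain B where B: "0 < B" "\<And>z. z \<in> closure D \<Longrightarrow> norm (f z) \<le> B"
    using compact_imp_bounded[OF compact_continuous_image[OF cont]] unfolding bounded_pos by auto
  define C where "C = 1 + B / d ^ N"
  have C: "1 \<le> C" "B / d ^ N \<le> C" using B d by (auto simp: C_def)
  have C_D: "norm (f z) \<le> C * norm z ^ N" if "z \<in> D" for z
  proof (cases "norm z < d")
    case True
    have "z \<noteq> 0" using that \<open>0 \<notin> D\<close> by blast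
    then have "norm (f z) \<le> 1 * norm z ^ N"
      using d(2)[of z] that True by (simp add: norm_divide norm_power divide_simps)
    also have "\<dots> \<le> C * norm z ^ N" using C by (intro mult_right_mono) auto
    finally show ?thesis .
  next
    case False
    have "z \<in> closure D" using that closure_subset by blast
    then have "norm (f z) \<le> B / d ^ N * d ^ N" using B(2)[of z] d by simp
    also have "\<dots> \<le> C * norm z ^ N"
      using C False d B by (intro mult_mono power_mono) auto
    finally show ?thesis .
  qed
  have "norm (f z) \<le> C * norm z ^ N" if "z \<in> closure D" for z
    by (rule bound_on_closure[of D "\<lambda>z. norm (f z)" "\<lambda>z. C * norm z ^ N"])
       (use C_D that cont in \<open>auto intro!: continuous_intros\<close>)
  then show ?thesis using that[of C] C by simp
qed

text \<open>
  A bounded function that is \<open>O(dist z c)\<close> for each point \<open>c\<close> of a finite set is also bounded by the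
  product of these distances, since at most one of them can be small at a time.
\<close>

lemma bound_by_prod_dist:
  fixes F :: "'a::real_normed_vector \<Rightarrow> real"
  assumes "finite S" "\<And>z. z \<in> D \<Longrightarrow> 0 \<le> F z \<and> F z \<le> K0"
    "\<And>c. c \<in> S \<Longrightarrow> \<exists>K. \<forall>z\<in>D. F z \<le> K * dist z c"
  shows "\<exists>K\<ge>0. \<forall>z\<in>D. F z \<le> K * (\<Prod>c\<in>S. dist z c)"
  using assms(1,3)
proof (induction S rule: finite_induct)
  case empty
  then show ?case using assms(2) by (intro exI[of _ "max K0 0"]) (fastforce simp: max_def)
next
  case (insert c S)
  obtain K where K: "K \<ge> 0" "\<forall>z\<in>D. F z \<le> K * (\<Prod>c\<in>S. dist z c)"
    using insert by blast
  obtain L where L: "\<forall>z\<in>D. F z \<le> L * dist z c" using insert.prems by blast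
  obtain \<eta> where \<eta>: "\<eta> > 0" "\<And>d. d \<in> S \<Longrightarrow> \<eta> \<le> dist c d"
  proof -
    have "\<exists>\<eta>>0. \<forall>d\<in>S. d \<noteq> c \<longrightarrow> \<eta> \<le> dist c d"
      using finite_set_avoid[OF insert.hyps(1), of c] by blast
    then show ?thesis using that insert.hyps(2) by metis
  qed
  define K' where "K' = \<bar>L\<bar> / (\<eta>/2) ^ card S + K / (\<eta>/2)"
  have "F z \<le> K' * (\<Prod>c\<in>insert c S. dist z c)" if z: "z \<in> D" for z
  proof (cases "dist z c < \<eta>/2")
    case True
    have "(\<eta>/2) ^ card S = (\<Prod>d\<in>S. \<eta>/2)" by simp
    also have "\<dots> \<le> (\<Prod>d\<in>S. dist z d)"
    proof (rule prod_mono, intro conjI)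
      fix d assume "d \<in> S"
      then show "\<eta>/2 \<le> dist z d"
        using \<eta>(2)[of d] True dist_triangle3[of c d z] by simp
    qed (use \<eta> in auto)
    finally have P: "(\<eta>/2) ^ card S \<le> (\<Prod>d\<in>S. dist z d)" .
    have "F z \<le> \<bar>L\<bar> * dist z c"
      using L z by (smt (verit) mult_right_mono zero_le_dist)
    also have "\<dots> = \<bar>L\<bar> / (\<eta>/2) ^ card S * dist z c * (\<eta>/2) ^ card S"
      using \<eta> by simp
    also have "\<dots> \<le> \<bar>L\<bar> / (\<eta>/2) ^ card S * dist z c * (\<Prod>d\<in>S. dist z d)"
      using \<eta> P by (intro mult_left_mono) auto
    also have "\<dots> \<le> K' * dist z c * (\<Prod>d\<in>S. dist z d)"
      using \<eta> K by (intro mult_right_mono prod_nonneg) (auto simp: K'_def)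
    finally show ?thesis using insert.hyps by (simp add: mult.assoc)
  next
    case False
    have "F z \<le> K * (\<Prod>d\<in>S. dist z d)" using K z by blast
    also have "\<dots> = K / (\<eta>/2) * (\<eta>/2) * (\<Prod>d\<in>S. dist z d)" using \<eta> by simp
    also have "\<dots> \<le> K' * dist z c * (\<Prod>d\<in>S. dist z d)"
      using \<eta> K False by (intro mult_right_mono prod_nonneg mult_mono) (auto simp: K'_def)
    finally show ?thesis using insert.hyps by (simp add: mult.assoc)
  qed
  moreover have "K' \<ge> 0" using \<eta> K by (auto simp: K'_def)
  ultimately show ?case by blast
qed

text \<open>
  Away from \<open>0\<close> the weight \<open>norm z ^ N\<close> is harmless and the Lipschitz bound serves; near \<open>0\<close> the
  distance to \<open>c\<close> is bounded below and the vanishing order serves.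
\<close>

lemma weighted_Lipschitz:
  assumes "c \<noteq> 0" "0 \<le> L"
    and "\<And>z. z \<in> D \<Longrightarrow> norm (f z) \<le> C * norm z ^ N"
    and "\<And>z. z \<in> D \<Longrightarrow> norm (f z) \<le> L * dist z c" and "0 \<notin> D" and "0 \<le> C"
  shows "\<exists>K. \<forall>z\<in>D. norm (f z) / norm z ^ N \<le> K * dist z (c::complex)"
proof (intro exI[of _ "2 * C / norm c + L / (norm c / 2) ^ N"] ballI)
  fix z assume z: "z \<in> D"
  then have z0: "z \<noteq> 0" using \<open>0 \<notin> D\<close> by auto
  let ?K1 = "2 * C / norm c" and ?K2 = "L / (norm c / 2) ^ N"
  have K: "0 \<le> ?K1" "0 \<le> ?K2" using assms by auto
  show "norm (f z) / norm z ^ N \<le> (?K1 + ?K2) * dist z c"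
  proof (cases "norm z < norm c / 2")
    case True
    have "norm c \<le> norm z + dist z c"
      by (metis dist_commute dist_norm norm_triangle_sub)
    then have "norm c / 2 \<le> dist z c" using True by simp
    have "norm (f z) / norm z ^ N \<le> C" using assms(3)[OF z] z0 by (simp add: field_simps)
    also have "C = ?K1 * (norm c / 2)" using assms(1) by simp
    also have "\<dots> \<le> (?K1 + ?K2) * dist z c"
      using K \<open>norm c / 2 \<le> dist z c\<close> by (intro mult_mono) auto
    finally show ?thesis .
  next
    case False
    have "norm (f z) / norm z ^ N \<le> (L * dist z c) / (norm c / 2) ^ N"
      using False assms z by (intro frac_le power_mono) auto
    also have "\<dots> = ?K2 * dist z c" by simp
    also have "\<dots> \<le> (?K1 + ?K2) * dist z c" using K by (intro mult_right_mono) auto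
    finally show ?thesis .
  qed
qed

section \<open>The moment estimate\<close>

lemma sgn_alt_quot_left:
  fixes t :: real
  assumes "\<And>c. c \<in> set cs \<Longrightarrow> t < c"
  shows "sgn (alt_quot cs t) = (-1) ^ length cs"
  unfolding sgn_alt_quot using assms by (induction cs) auto

text \<open>
  All constants are independent of \<open>\<delta>\<close> except for the choice between \<open>N\<close> and \<open>Suc N\<close>: the signs
  of the integrand on the two sides of \<open>0\<close> must agree, and the parity of the exponent of \<open>t\<close> is
  used to achieve this. The first term on the left is the contribution of \<open>[a, b]\<close>, the
  second one that of \<open>[-\<delta>, \<delta>]\<close>, and the right-hand side bounds the integral over the
  other three sides of the rectangle.
\<close>

lemma moment_estimate:
  fixes f :: "complex \<Rightarrow> complex" and C :: "nat \<Rightarrow> real"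
  defines "u \<equiv> \<lambda>t. Re (f (complex_of_real t))"
  assumes hol: "f holomorphic_on upper_half_disc"
    and cont: "continuous_on (closure upper_half_disc) f"
    and L: "0 \<le> L" "\<And>z w. z \<in> closure upper_half_disc \<Longrightarrow> w \<in> closure upper_half_disc \<Longrightarrow>
      norm (f z - f w) \<le> L * norm (z - w)"
    and C: "\<And>n. 0 \<le> C n"
      "\<And>n z. z \<in> closure upper_half_disc \<Longrightarrow> norm (f z) \<le> C n * norm z ^ n"
    and u0: "\<And>t. \<bar>t\<bar> < 1 \<Longrightarrow> u t = 0 \<Longrightarrow> f (of_real t) = 0"
    and r: "r < 1/2" and \<theta>: "0 < \<theta>" "\<theta> \<le> r"
    and r_far: "\<And>t. \<bar>t\<bar> < 1 \<Longrightarrow> u t = 0 \<Longrightarrow> \<theta> \<le> \<bar>t - r\<bar> \<and> \<theta> \<le> \<bar>t + r\<bar>"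
    and ab: "a \<le> b" "b < r"
    and ab_far: "\<And>x t. x \<in> {a..b} \<Longrightarrow> \<bar>t\<bar> < 1 \<Longrightarrow> u t = 0 \<Longrightarrow> \<theta> \<le> \<bar>x - t\<bar>"
    and m: "0 \<le> m" "\<And>x. x \<in> {a..b} \<Longrightarrow> m \<le> \<bar>u x\<bar>"
    and \<delta>: "0 < \<delta>" "\<delta> < a"
    and fin: "finite {t. \<delta> < \<bar>t\<bar> \<and> \<bar>t\<bar> < 1/2 \<and> u t = 0}"
  shows "\<exists>n\<in>{N, Suc N}. (b - a) * (m * (\<theta> * exp (- (1 / \<theta>)))\<^sup>2 / b ^ n) - 2 * \<delta> * (4 * C n)
      \<le> 4 * r * (C 0 * (2 * exp (1 / \<theta>))\<^sup>2 / r ^ n)"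
proof -
  let ?D = upper_half_disc
  have r0: "0 < r" and \<theta>1: "\<theta> \<le> 1" and b0: "0 < b" using \<theta> r ab \<delta> by auto
  have Dcl: "z \<in> closure ?D" if "z \<in> ?D" for z using that closure_subset by blast
  have tcl: "complex_of_real t \<in> closure ?D" if "\<bar>t\<bar> < 1" for t
    using that diameter_subset_closure by (force simp: half_disc_diameter_def)
  have ucont: "continuous_on {-1<..<1} u"
    unfolding u_def by (intro continuous_intros continuous_on_compose2[OF cont])
      (auto intro!: tcl simp: abs_less_iff)
  have "continuous_on {\<delta><..<1/2} u"
    by (rule continuous_on_subset[OF ucont]) (use \<delta> in auto)
  moreover have "finite {t \<in> {\<delta><..<1/2}. u t = 0}"
    by (rule finite_subset[OF _ fin]) (use \<delta> in auto)
  ultimately obtain cs s where cs: "sorted cs" "distinct cs"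
    "set cs \<subseteq> {t \<in> {\<delta><..<1/2}. u t = 0}" "\<bar>s\<bar> = 1"
    "\<And>t. t \<in> {\<delta><..<1/2} \<Longrightarrow> u t \<noteq> 0 \<Longrightarrow> sgn (u t) = s * sgn (alt_quot cs t)"
    by (rule sign_changes_list) blast
  have "continuous_on {\<delta><..<1/2} (\<lambda>t. u (-t))"
    by (intro continuous_on_compose2[OF ucont] continuous_intros) (use \<delta> in auto)
  moreover have "{t \<in> {\<delta><..<1/2}. u (-t) = 0} \<subseteq> uminus ` {t. \<delta> < \<bar>t\<bar> \<and> \<bar>t\<bar> < 1/2 \<and> u t = 0}"
  proof
    fix t assume "t \<in> {t \<in> {\<delta><..<1/2}. u (-t) = 0}"
    then show "t \<in> uminus ` {t. \<delta> < \<bar>t\<bar> \<and> \<bar>t\<bar> < 1/2 \<and> u t = 0}"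
      using \<delta> by (intro image_eqI[of _ uminus "- t"]) auto
  qed
  then have "finite {t \<in> {\<delta><..<1/2}. u (-t) = 0}"
    using fin finite_surj by blast
  ultimately obtain ds s' where ds: "sorted ds" "distinct ds"
    "set ds \<subseteq> {t \<in> {\<delta><..<1/2}. u (-t) = 0}" "\<bar>s'\<bar> = 1"
    "\<And>t. t \<in> {\<delta><..<1/2} \<Longrightarrow> u (-t) \<noteq> 0 \<Longrightarrow> sgn (u (-t)) = s' * sgn (alt_quot ds t)"
    by (rule sign_changes_list) blast
  have csD: "\<delta> < c \<and> c < 1/2 \<and> u c = 0" if "c \<in> set cs" for c using cs(3) that by auto
  have dsD: "\<delta> < c \<and> c < 1/2 \<and> u (-c) = 0" if "c \<in> set ds" for c using ds(3) that by auto
  \<comment> \<open>\<open>cs\<close> lists the sign changes to the right of \<open>\<delta>\<close>, and \<open>ds\<close> the negatives of those to the left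
    of \<open>-\<delta>\<close>. Both reach up to \<open>1/2\<close> rather than \<open>r\<close>, so that the signs are right at \<open>\<plusminus>r\<close>, too.\<close>
  define G :: "complex \<Rightarrow> complex" where "G z = alt_quot cs z * alt_quot ds (- z)" for z
  define g :: "real \<Rightarrow> real" where "g t = alt_quot cs t * alt_quot ds (- t)" for t
  have Gg: "G (of_real t) = of_real (g t)" for t
    unfolding G_def g_def using alt_quot_of_real[of ds "-t", where 'a=complex]
    by (simp add: alt_quot_of_real)
  define \<sigma> where "\<sigma> = s * (-1) ^ length ds"
  have \<sigma>: "\<bar>\<sigma>\<bar> = 1" using cs(4) by (simp add: \<sigma>_def abs_mult power_abs)
  obtain n where n: "n \<in> {N, Suc N}" "\<sigma> = s' * (-1) ^ length cs * (-1) ^ n"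
  proof -
    have "\<bar>s' * (-1) ^ length cs * (-1) ^ N\<bar> = 1" using ds(4) by (simp add: abs_mult power_abs)
    then have "\<sigma> = s' * (-1) ^ length cs * (-1) ^ N \<or> \<sigma> = s' * (-1) ^ length cs * (-1) ^ Suc N"
      using \<sigma> by (auto simp: abs_if split: if_splits)
    then show ?thesis using that by blast
  qed
  define h where "h t = u t * g t / t ^ n" for t
  have sign: "\<sigma> * h t = \<bar>h t\<bar>" if t: "\<delta> < \<bar>t\<bar>" "\<bar>t\<bar> < 1/2" for t
  proof (cases "h t = 0")
    case False
    then have ut: "u t \<noteq> 0" and gt: "g t \<noteq> 0" by (auto simp: h_def)
    have "sgn (h t) = \<sigma>"
    proof (cases "t > 0")
      case True
      have "sgn (alt_quot ds (- t)) = (-1) ^ length ds"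
        by (rule sgn_alt_quot_left) (use dsD \<delta> True in force)
      moreover have "sgn (u t) = s * sgn (alt_quot cs t)" using cs(5)[of t] t True ut by auto
      moreover have "sgn (alt_quot cs t) * sgn (alt_quot cs t) = 1"
        using gt by (simp add: g_def sgn_real_def)
      ultimately show ?thesis using True
        by (simp add: h_def g_def sgn_mult sgn_divide \<sigma>_def)
    next
      case neg: False
      have "sgn (alt_quot cs t) = (-1) ^ length cs"
        by (rule sgn_alt_quot_left) (use csD \<delta> neg in force)
      moreover have "sgn (u t) = s' * sgn (alt_quot ds (- t))" using ds(5)[of "-t"] t neg ut by auto
      moreover have "sgn (alt_quot ds (- t)) = 1 \<or> sgn (alt_quot ds (- t)) = -1"
        using gt by (simp add: g_def sgn_real_def)
      moreover have "sgn (t ^ n) = (-1) ^ n" using neg t \<delta> power_sgn[of t n] by simp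
      ultimately show ?thesis unfolding n(2) h_def g_def sgn_mult sgn_divide
        by (cases "even n") auto
    qed
    then show ?thesis by (simp add: abs_sgn mult.commute)
  qed auto
  define \<Phi> where "\<Phi> z = f z * G z / z ^ n" for z
  have \<Phi>h: "Re (\<Phi> (of_real t)) = h t" for t
    unfolding \<Phi>_def Gg h_def u_def by (simp flip: of_real_power)
  define M where "M = C 0 * (2 * exp (1 / \<theta>))\<^sup>2 / r ^ n"
  define Z where "Z = insert 0 (set cs \<union> uminus ` set ds)"
  have offreal: "z \<noteq> of_real c" "- z \<noteq> of_real c" if "z \<in> ?D" for z c
    using that by (auto simp: upper_half_disc_def complex_eq_iff)
  have D0: "0 \<notin> ?D" by (auto simp: upper_half_disc_def)
  have dist2: "norm (z - of_real c) \<le> 2" "norm (- z - of_real c) \<le> 2"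
    if "z \<in> ?D" "c \<in> set cs \<union> set ds" for z c
  proof -
    have "norm z < 1" "\<bar>c\<bar> \<le> 1" using that csD[of c] dsD[of c] \<delta> by (auto simp: upper_half_disc_def)
    then show "norm (z - of_real c) \<le> 2" "norm (- z - of_real c) \<le> 2"
      using norm_triangle_ineq4[of z "of_real c"] norm_triangle_ineq4[of "- z" "of_real c"] by auto
  qed
  have hol\<Phi>: "\<Phi> holomorphic_on ?D"
    unfolding \<Phi>_def G_def using D0 offreal
    by (intro holomorphic_intros hol) auto
  have bdd: "\<exists>K. \<forall>z\<in>?D. norm (\<Phi> z) \<le> K"
  proof -
    \<comment> \<open>The entries of both lists, as zeros of \<open>f\<close> on the diameter.\<close>
    let ?ws = "map complex_of_real (cs @ map uminus ds)"
    have ws0: "distinct ?ws"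
      using cs(2) ds(2) csD dsD \<delta> by (force simp: distinct_map inj_on_def)
    have "\<exists>K\<ge>0. \<forall>z\<in>?D. norm (f z) / norm z ^ n \<le> K * (\<Prod>c\<in>set ?ws. dist z c)"
    proof (rule bound_by_prod_dist)
      show "0 \<le> norm (f z) / norm z ^ n \<and> norm (f z) / norm z ^ n \<le> C n" if "z \<in> ?D" for z
        using C(2)[OF Dcl[OF that], of n] C(1)[of n] D0 that
        by (cases "z = 0") (auto simp: field_simps)
      fix c assume "c \<in> set ?ws"
      then obtain t where t: "c = of_real t" "t \<noteq> 0" "\<bar>t\<bar> < 1" "u t = 0"
        using csD dsD \<delta> by fastforce
      show "\<exists>K. \<forall>z\<in>?D. norm (f z) / norm z ^ n \<le> K * dist z c"
      proof (rule weighted_Lipschitz[where C = "C n" and L = L])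
        show "norm (f z) \<le> L * dist z c" if "z \<in> ?D" for z
          using L(2)[OF Dcl[OF that] tcl[OF t(3)]] u0[OF t(3,4)] by (simp add: t dist_norm)
      qed (use t L C D0 Dcl in auto)
    qed auto
    then obtain K where K: "K \<ge> 0" "\<forall>z\<in>?D. norm (f z) / norm z ^ n \<le> K * (\<Prod>c\<in>set ?ws. dist z c)"
      by blast
    have "norm (\<Phi> z) \<le> K * (2 ^ (2 * length cs) * 2 ^ (2 * length ds))" if z: "z \<in> ?D" for z
    proof -
      let ?Pc = "\<Prod>c\<leftarrow>cs. norm (z - of_real c)" and ?Pd = "\<Prod>c\<leftarrow>ds. norm (- z - of_real c)"
      have P: "(\<Prod>c\<in>set ?ws. dist z c) = ?Pc * ?Pd"
        unfolding prod.distinct_set_conv_list[OF ws0]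
        by (simp add: dist_norm o_def norm_minus_commute[of "- z" "of_real _"] add.commute)
      have "norm (\<Phi> z) = norm (f z) / norm z ^ n * (norm (alt_quot cs z) * norm (alt_quot ds (- z)))"
        by (simp add: \<Phi>_def G_def norm_mult norm_divide norm_power)
      also have "\<dots> \<le> K * (?Pc * ?Pd) * (norm (alt_quot cs z) * norm (alt_quot ds (- z)))"
        using K z unfolding P[symmetric] by (intro mult_right_mono) auto
      also have "\<dots> = K * ((norm (alt_quot cs z) * ?Pc) * (norm (alt_quot ds (- z)) * ?Pd))"
        by (simp only: mult_ac)
      also have "\<dots> \<le> K * (2 ^ (2 * length cs) * 2 ^ (2 * length ds))"
        using K dist2[OF z] by (intro mult_left_mono mult_mono norm_alt_quot_times_prod_le
            mult_nonneg_nonneg prod_list_nonneg) auto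
      finally show ?thesis .
    qed
    then show ?thesis by blast
  qed
  then obtain K where K: "\<And>z. z \<in> ?D \<Longrightarrow> norm (\<Phi> z) \<le> K" by blast
  have side: "norm (\<Phi> z) \<le> M" if z: "z \<in> ?D" "\<bar>Re z\<bar> = r \<or> Im z = r" for z
  proof -
    have far: "\<theta> \<le> norm (z - of_real t)" if "\<bar>t\<bar> < 1" "u t = 0" for t
      using r_far[OF that] z(2) \<theta> abs_Re_le_cmod[of "z - of_real t"] abs_Im_le_cmod[of "z - of_real t"]
      by (auto simp: abs_if split: if_splits)
    have cz: "norm (alt_quot cs z) \<le> 2 * exp ((1 - 0) / \<theta>)"
      by (rule norm_alt_quot_le)
         (use \<theta> cs(1) dist2[OF z(1)] in \<open>auto dest!: csD intro!: far simp: less_imp_le\<close>, use \<delta> in auto)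
    have "\<theta> \<le> norm (- z - of_real c)" if "c \<in> set ds" for c
      using far[of "-c"] dsD[OF that] \<delta> norm_minus_commute[of "- z" "of_real c"]
      by (simp add: add.commute)
    then have dz: "norm (alt_quot ds (- z)) \<le> 2 * exp ((1 - 0) / \<theta>)"
      by (intro norm_alt_quot_le)
         (use \<theta> \<delta> ds(1) dist2[OF z(1)] in \<open>auto dest!: dsD\<close>)
    have "r \<le> norm z" using z(2) abs_Re_le_cmod[of z] abs_Im_le_cmod[of z] by linarith
    have "norm (\<Phi> z) = norm (f z) * (norm (alt_quot cs z) * norm (alt_quot ds (- z))) / norm z ^ n"
      by (simp add: \<Phi>_def G_def norm_mult norm_divide norm_power)
    also have "\<dots> \<le> C 0 * ((2 * exp (1 / \<theta>)) * (2 * exp (1 / \<theta>))) / r ^ n"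
      using cz dz r0 \<open>r \<le> norm z\<close> C(1)[of 0] C(2)[OF Dcl[OF z(1)], of 0]
      by (intro frac_le mult_mono power_mono mult_nonneg_nonneg) auto
    finally show ?thesis by (simp add: M_def power2_eq_square)
  qed
  have lim: "(\<Phi> \<longlongrightarrow> \<Phi> (of_real t)) (at (of_real t) within ?D)" if t: "t \<in> {-r..r} - Z" for t
  proof -
    have "\<bar>t\<bar> < 1" using t r by auto
    then have "(f \<longlongrightarrow> f (of_real t)) (at (of_real t) within closure ?D)"
      using cont tcl unfolding continuous_on_def by blast
    then have "(f \<longlongrightarrow> f (of_real t)) (at (of_real t) within ?D)"
      by (rule tendsto_within_subset[OF _ closure_subset])
    moreover have "((\<lambda>z. alt_quot cs z) \<longlongrightarrow> alt_quot cs (of_real t)) (at (of_real t) within ?D)"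
      by (intro tendsto_alt_quot tendsto_ident_at) (use t in \<open>auto simp: Z_def\<close>)
    moreover have "((\<lambda>z. alt_quot ds (- z)) \<longlongrightarrow> alt_quot ds (- of_real t)) (at (of_real t) within ?D)"
    proof (intro tendsto_alt_quot tendsto_minus tendsto_ident_at)
      fix c assume "c \<in> set ds"
      then have "t \<noteq> - c" using t unfolding Z_def by blast
      then have "- t \<noteq> c" by linarith
      then show "- complex_of_real t \<noteq> of_real c" by (metis of_real_eq_iff of_real_minus)
    qed
    moreover have "complex_of_real t ^ n \<noteq> 0" using t by (simp add: Z_def)
    ultimately show ?thesis
      unfolding \<Phi>_def G_def
      by (intro tendsto_divide tendsto_mult tendsto_power tendsto_ident_at)
  qed
  have Zfin: "finite Z" by (simp add: Z_def)
  note est = rectangle_estimate[OF hol\<Phi> r0 r Zfin K side lim]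
  have hint: "((\<lambda>t. \<sigma> * h t) has_integral (\<sigma> * Re (integral {-r..r} (\<lambda>t. \<Phi> (of_real t))))) {-r..r}"
    using has_integral_Re[OF integrable_integral[OF est(1)]] by (intro has_integral_mult_right) (simp add: \<Phi>h)
  define \<kappa> where "\<kappa> = m * (\<theta> * exp (- (1 / \<theta>)))\<^sup>2 / b ^ n"
  \<comment> \<open>A step function below the integrand.\<close>
  define w where "w t = (if t \<in> {a..b} then \<kappa> else 0) + (if t \<in> {-\<delta>..\<delta>} then - (4 * C n) else 0)" for t
  have wint: "(w has_integral ((b - a) * \<kappa> + 2 * \<delta> * - (4 * C n))) {-r..r}"
  proof -
    have "((\<lambda>t. if t \<in> {a..b} then \<kappa> else 0) has_integral (b - a) * \<kappa>) {-r..r}"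
      using has_integral_const_real[of \<kappa> a b] ab \<delta> by (subst has_integral_restrict) auto
    moreover have "((\<lambda>t. if t \<in> {-\<delta>..\<delta>} then - (4 * C n) else 0) has_integral 2 * \<delta> * - (4 * C n)) {-r..r}"
      using has_integral_const_real[of "- (4 * C n)" "-\<delta>" \<delta>] ab \<delta> by (subst has_integral_restrict) auto
    ultimately show ?thesis unfolding w_def by (rule has_integral_add)
  qed
  have wh: "w t \<le> \<sigma> * h t" if t: "t \<in> {-r..r}" for t
  proof -
    consider "t \<in> {a..b}" | "t \<in> {-\<delta>..\<delta>}" | "\<delta> < \<bar>t\<bar>" "t \<notin> {a..b}" by fastforce
    then show ?thesis
    proof cases
      case 1
      have "\<theta> * exp (- ((1 - 0) / \<theta>)) \<le> norm (alt_quot cs t)"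
        by (rule norm_alt_quot_ge)
           (use \<theta> \<theta>1 \<delta> cs(1) ab_far[OF 1] in \<open>auto dest!: csD\<close>)
      moreover have "\<theta> \<le> \<bar>- t - c\<bar>" if "c \<in> set ds" for c
        using ab_far[OF 1, of "-c"] dsD[OF that] \<delta> by auto
      then have "\<theta> * exp (- ((1 - 0) / \<theta>)) \<le> norm (alt_quot ds (- t))"
        by (intro norm_alt_quot_ge) (use \<theta> \<theta>1 \<delta> ds(1) in \<open>auto dest!: dsD\<close>)
      ultimately have "m * ((\<theta> * exp (- (1 / \<theta>))) * (\<theta> * exp (- (1 / \<theta>)))) / b ^ n
          \<le> \<bar>u t\<bar> * (\<bar>alt_quot cs t\<bar> * \<bar>alt_quot ds (- t)\<bar>) / \<bar>t\<bar> ^ n"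
        using m 1 \<theta> \<delta> by (intro frac_le mult_mono power_mono mult_nonneg_nonneg) auto
      then have "\<kappa> \<le> \<bar>h t\<bar>"
        by (simp add: \<kappa>_def h_def g_def power2_eq_square abs_mult power_abs)
      then show ?thesis using 1 \<delta> ab r sign[of t] by (auto simp: w_def)
    next
      case 2
      have "\<bar>alt_quot cs t\<bar> \<le> 2" "\<bar>alt_quot ds (- t)\<bar> \<le> 2"
        using cs(1) ds(1) 2 t r by (intro abs_alt_quot_le; force dest!: csD dsD)+
      then have g4: "\<bar>g t\<bar> \<le> 4"
        using mult_mono[of "\<bar>alt_quot cs t\<bar>" 2 "\<bar>alt_quot ds (- t)\<bar>" 2] by (simp add: g_def abs_mult)
      have "\<bar>t\<bar> < 1" using t r by auto
      then have "\<bar>u t\<bar> \<le> C n * \<bar>t\<bar> ^ n"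
        using C(2)[OF tcl, of t n] abs_Re_le_cmod[of "f (of_real t)"] by (auto simp: u_def)
      then have ug: "\<bar>u t\<bar> * \<bar>g t\<bar> \<le> (C n * \<bar>t\<bar> ^ n) * 4"
        using g4 C(1)[of n] by (intro mult_mono) auto
      have "\<bar>h t\<bar> \<le> 4 * C n"
      proof (cases "t ^ n = 0")
        case True
        show ?thesis unfolding h_def True using C(1)[of n] by simp
      next
        case False
        then have "0 < \<bar>t\<bar> ^ n" by (simp add: power_abs flip: zero_less_abs_iff)
        then show ?thesis using ug by (simp add: h_def abs_mult power_abs field_simps)
      qed
      moreover have "\<bar>\<sigma> * h t\<bar> = \<bar>h t\<bar>" using \<sigma> by (simp add: abs_mult)
      moreover have "w t = - (4 * C n)" using 2 \<delta> by (simp add: w_def)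
      ultimately show ?thesis by linarith
    next
      case 3
      then have "w t = 0" by (auto simp: w_def)
      then show ?thesis using sign[of t] 3 t r by auto
    qed
  qed
  have "(b - a) * \<kappa> + 2 * \<delta> * - (4 * C n) \<le> \<sigma> * Re (integral {-r..r} (\<lambda>t. \<Phi> (of_real t)))"
    by (rule has_integral_le[OF wint hint]) (use wh in auto)
  also have "\<dots> \<le> \<bar>\<sigma> * Re (integral {-r..r} (\<lambda>t. \<Phi> (of_real t)))\<bar>" by simp
  also have "\<dots> \<le> norm (integral {-r..r} (\<lambda>t. \<Phi> (of_real t)))"
    using \<sigma> abs_Re_le_cmod by (simp add: abs_mult)
  also have "\<dots> \<le> 4 * r * M" by (rule est(2))
  finally show ?thesis using n(1) unfolding \<kappa>_def M_def by (intro bexI[of _ n]) auto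
qed

section \<open>Zeros on the diameter\<close>

lemma finite_real_zeros:
  assumes "zeros_discrete_away_from_0 f" and "compact K" "K \<subseteq> {-1<..<1}" "0 \<notin> K"
  shows "finite {t \<in> K. f (complex_of_real t) = 0}"
proof (rule ccontr)
  let ?T = "{t \<in> K. f (complex_of_real t) = 0}"
  assume "infinite ?T"
  then obtain x where x: "x \<in> K" "x islimpt ?T"
    using \<open>compact K\<close> unfolding compact_eq_Bolzano_Weierstrass by (metis (no_types, lifting) mem_Collect_eq subsetI)
  have "complex_of_real x islimpt diameter_zeros f"
    unfolding islimpt_approachable
  proof (intro allI impI)
    fix e :: real assume "e > 0"
    then obtain t where t: "t \<in> ?T" "t \<noteq> x" "dist t x < e"
      using x(2) unfolding islimpt_approachable by blast
    have "complex_of_real t \<in> diameter_zeros f"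
      using t assms(3) by (auto simp: diameter_zeros_def half_disc_diameter_def)
    then show "\<exists>z\<in>diameter_zeros f. z \<noteq> complex_of_real x \<and> dist z (complex_of_real x) < e"
      using t by (intro bexI[of _ "complex_of_real t"]) auto
  qed
  moreover have "complex_of_real x \<in> half_disc_diameter"
    using x assms(3) by (auto simp: half_disc_diameter_def)
  ultimately have "complex_of_real x = 0"
    using assms(1) unfolding zeros_discrete_away_from_0_def by blast
  then show False using x assms(4) by simp
qed

lemma zeros_far_from_nonzero:
  fixes u :: "real \<Rightarrow> real"
  assumes "continuous_on {-1<..<1} u" "\<bar>x\<bar> < 1" "u x \<noteq> 0"
  obtains e where "e > 0" "\<And>t. \<bar>t\<bar> < 1 \<Longrightarrow> u t = 0 \<Longrightarrow> e \<le> \<bar>t - x\<bar>"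
proof -
  have "isCont u x"
    by (rule continuous_on_interior[OF assms(1)]) (use assms(2) in \<open>auto simp: abs_less_iff\<close>)
  then have "\<exists>e>0. \<forall>t. dist x t < e \<longrightarrow> u t \<noteq> 0"
    using continuous_at_avoid assms(3) by blast
  then show ?thesis using that by (metis dist_commute dist_real_def not_less)
qed

section \<open>Conclusion\<close>

theorem theorem3:
  fixes f :: "complex \<Rightarrow> complex"
  assumes "f holomorphic_on upper_half_disc"
    and "smooth_on_closure upper_half_disc f"
    and "f ` half_disc_diameter \<subseteq> Gamma_infty"
    and "zeros_discrete_away_from_0 f"
    and "vanishes_to_infinite_order upper_half_disc f 0"
  shows "\<forall>z \<in> closure upper_half_disc. f z = 0"
proof -
  let ?D = upper_half_disc
  have cont: "continuous_on (closure ?D) f"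
    using assms(2) by (simp add: smooth_on_closure_def)
  obtain L where L: "0 \<le> L" "\<And>z w. z \<in> closure ?D \<Longrightarrow> w \<in> closure ?D \<Longrightarrow>
      norm (f z - f w) \<le> L * norm (z - w)"
    using smooth_imp_Lipschitz[OF assms(1,2)] by blast
  have "bounded ?D" "0 \<notin> ?D"
    by (auto simp: upper_half_disc_def intro: boundedI[of _ 1])
  then have "\<exists>C\<ge>0. \<forall>z\<in>closure ?D. norm (f z) \<le> C * norm z ^ n" for n
    using infinite_order_bound[OF cont _ _ assms(5)] by metis
  then obtain C where C: "\<And>n. 0 \<le> C n"
      "\<And>n z. z \<in> closure ?D \<Longrightarrow> norm (f z) \<le> C n * norm z ^ n"
    by metis
  define u where "u t = Re (f (complex_of_real t))" for t
  have tcl: "complex_of_real t \<in> closure ?D" if "\<bar>t\<bar> < 1" for t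
    using that diameter_subset_closure by (force simp: half_disc_diameter_def)
  have ucont: "continuous_on {-1<..<1} u"
    unfolding u_def by (intro continuous_intros continuous_on_compose2[OF cont])
      (auto intro!: tcl simp: abs_less_iff)
  have u0: "f (of_real t) = 0" if "\<bar>t\<bar> < 1" "u t = 0" for t
  proof -
    have "f (of_real t) \<in> Gamma_infty"
      using assms(3) that by (auto simp: half_disc_diameter_def abs_less_iff)
    moreover have "f (of_real t) = \<i> * complex_of_real (Im (f (of_real t)))"
      using that(2) by (simp add: u_def complex_eq_iff)
    ultimately show ?thesis unfolding Gamma_infty_def by blast
  qed
  have fin: "finite {t \<in> K. u t = 0}" if "compact K" "K \<subseteq> {-1<..<1}" "0 \<notin> K" for K
  proof (rule finite_subset[OF _ finite_real_zeros[OF assms(4) that]])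
    show "{t \<in> K. u t = 0} \<subseteq> {t \<in> K. f (of_real t) = 0}"
      using u0 that(2) by (force simp: abs_less_iff)
  qed
  \<comment> \<open>A nonzero value at \<open>p\<close> inside the rectangle, and nonzero values at its two corners \<open>\<plusminus>r\<close> on the diameter.\<close>
  obtain p where p: "p \<in> {1/8..1/4}" "u p \<noteq> 0"
  proof -
    have "infinite {1/8..1/4::real}" by (simp add: infinite_Icc)
    moreover have "finite {t \<in> {1/8..1/4}. u t = 0}" by (intro fin) auto
    ultimately have "{1/8..1/4} \<noteq> {t \<in> {1/8..1/4}. u t = 0}" by metis
    then show ?thesis using that by blast
  qed
  obtain r where r: "r \<in> {3/8..7/16}" "u r \<noteq> 0" "u (- r) \<noteq> 0"
  proof -
    let ?I = "{3/8..7/16::real}" and ?J = "{-7/16..-3/8::real}"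
    have "infinite ?I" by (simp add: infinite_Icc)
    moreover have "finite ({t \<in> ?I. u t = 0} \<union> uminus ` {t \<in> ?J. u t = 0})"
      by (intro finite_UnI finite_imageI fin) auto
    ultimately obtain r where "r \<in> ?I" "r \<notin> {t \<in> ?I. u t = 0} \<union> uminus ` {t \<in> ?J. u t = 0}"
      by (meson finite_subset subsetI)
    moreover have "r \<in> uminus ` {t \<in> ?J. u t = 0}" if "r \<in> ?I" "u (- r) = 0" for r
      using that by (intro image_eqI[of _ uminus "- r"]) auto
    ultimately show ?thesis using that by blast
  qed
  \<comment> \<open>One distance \<open>\<theta>\<close> separates all zeros from \<open>\<plusminus>r\<close> and from the interval \<open>[a, b]\<close> around \<open>p\<close>.\<close>
  obtain e1 where e1: "e1 > 0" "\<And>t. \<bar>t\<bar> < 1 \<Longrightarrow> u t = 0 \<Longrightarrow> e1 \<le> \<bar>t - r\<bar>"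
    using zeros_far_from_nonzero[OF ucont, of r] r by auto
  obtain e2 where e2: "e2 > 0" "\<And>t. \<bar>t\<bar> < 1 \<Longrightarrow> u t = 0 \<Longrightarrow> e2 \<le> \<bar>t - - r\<bar>"
    using zeros_far_from_nonzero[OF ucont, of "- r"] r by auto
  obtain e3 where e3: "e3 > 0" "\<And>t. \<bar>t\<bar> < 1 \<Longrightarrow> u t = 0 \<Longrightarrow> e3 \<le> \<bar>t - p\<bar>"
    using zeros_far_from_nonzero[OF ucont, of p] p by auto
  define \<eta> where "\<eta> = min (e3 / 2) (1/32)"
  define \<theta> where "\<theta> = min (min e1 e2) \<eta>"
  have \<eta>: "0 < \<eta>" "\<eta> \<le> e3 / 2" "\<eta> \<le> 1/32" using e3 by (auto simp: \<eta>_def)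
  have \<theta>: "0 < \<theta>" "\<theta> \<le> e1" "\<theta> \<le> e2" "\<theta> \<le> \<eta>" using e1 e2 \<eta> by (auto simp: \<theta>_def)
  define a b where "a = p - \<eta>" and "b = p + \<eta>"
  have ab: "1/16 < a" "a < b" "b < r" "b - a = 2 * \<eta>" "0 < b" using p r \<eta> by (auto simp: a_def b_def)
  have ab_far: "\<theta> \<le> \<bar>x - t\<bar>" if "x \<in> {a..b}" "\<bar>t\<bar> < 1" "u t = 0" for x t
    using e3(2)[OF that(2,3)] that(1) \<eta> \<theta> by (auto simp: a_def b_def abs_if split: if_splits)
  have "\<exists>x\<in>{a..b}. \<forall>y\<in>{a..b}. \<bar>u x\<bar> \<le> \<bar>u y\<bar>"
    by (rule continuous_attains_inf)
       (use ab r in \<open>auto intro!: continuous_intros continuous_on_subset[OF ucont]\<close>)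
  then obtain x where x: "x \<in> {a..b}" "\<And>y. y \<in> {a..b} \<Longrightarrow> \<bar>u x\<bar> \<le> \<bar>u y\<bar>" by blast
  define m where "m = \<bar>u x\<bar>"
  have "0 < m" using ab_far[of x x] x(1) ab r \<theta> by (auto simp: m_def)
  \<comment> \<open>The moment estimate will read \<open>A / b^n \<le> B / r^n + 8 * C n * \<delta>\<close>. Since \<open>b < r\<close>, this fails for
    large \<open>n\<close> once \<open>\<delta>\<close> is so small that the last term is at most \<open>1 / r^n\<close>.\<close>
  define A where "A = 2 * \<eta> * m * (\<theta> * exp (- (1 / \<theta>)))\<^sup>2"
  define B where "B = 4 * r * C 0 * (2 * exp (1 / \<theta>))\<^sup>2"
  have "0 < A" using \<eta> \<theta> \<open>0 < m\<close> by (auto simp: A_def)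
  have "1 < r / b" using ab by simp
  then obtain N where N: "(B + 1) / A < (r / b) ^ N" using real_arch_pow by blast
  define \<delta> where "\<delta> = min (1/16) (r ^ Suc N / (8 * (C N + C (Suc N) + 1)))"
  have \<delta>: "\<delta> \<le> 1/16" "\<delta> \<le> r ^ Suc N / (8 * (C N + C (Suc N) + 1))"
    unfolding \<delta>_def by (rule min.cobounded1, rule min.cobounded2)
  have \<delta>0: "0 < \<delta>"
    using r C(1)[of N] C(1)[of "Suc N"] by (simp add: \<delta>_def)
  have "\<exists>n\<in>{N, Suc N}. (b - a) * (m * (\<theta> * exp (- (1 / \<theta>)))\<^sup>2 / b ^ n) - 2 * \<delta> * (4 * C n)
      \<le> 4 * r * (C 0 * (2 * exp (1 / \<theta>))\<^sup>2 / r ^ n)"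
  proof (rule moment_estimate[OF assms(1) cont L C, folded u_def])
    have "{t. \<delta> < \<bar>t\<bar> \<and> \<bar>t\<bar> < 1/2 \<and> u t = 0} \<subseteq> {t \<in> {\<delta>..1/2} \<union> {-1/2..-\<delta>}. u t = 0}"
      by auto
    moreover have "finite {t \<in> {\<delta>..1/2} \<union> {-1/2..-\<delta>}. u t = 0}"
      using \<delta> \<delta>0 by (intro fin compact_Un) auto
    ultimately show "finite {t. \<delta> < \<bar>t\<bar> \<and> \<bar>t\<bar> < 1/2 \<and> u t = 0}"
      by (rule finite_subset)
    show "\<theta> \<le> \<bar>t - r\<bar> \<and> \<theta> \<le> \<bar>t + r\<bar>" if "\<bar>t\<bar> < 1" "u t = 0" for t
      using e1(2)[OF that] e2(2)[OF that] \<theta> by auto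
    show "m \<le> \<bar>u y\<bar>" if "y \<in> {a..b}" for y using x(2)[OF that] by (simp add: m_def)
  qed (use u0 r \<theta> \<eta> ab ab_far \<open>0 < m\<close> \<delta> \<delta>0 in auto)
  then obtain n where n: "n \<in> {N, Suc N}"
    and est: "(b - a) * (m * (\<theta> * exp (- (1 / \<theta>)))\<^sup>2 / b ^ n) - 2 * \<delta> * (4 * C n)
      \<le> 4 * r * (C 0 * (2 * exp (1 / \<theta>))\<^sup>2 / r ^ n)" by blast
  have est': "A / b ^ n \<le> B / r ^ n + 8 * C n * \<delta>"
    using est by (simp add: A_def B_def ab(4) algebra_simps)
  have "8 * C n * \<delta> \<le> 8 * (C N + C (Suc N) + 1) * (r ^ Suc N / (8 * (C N + C (Suc N) + 1)))"
    using n \<delta> \<delta>0 C(1)[of N] C(1)[of "Suc N"] by (intro mult_mono) auto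
  also have "\<dots> = r ^ Suc N" using C(1)[of N] C(1)[of "Suc N"] by simp
  finally have "8 * C n * \<delta> * r ^ n \<le> r ^ Suc N * r ^ n" using r by (intro mult_right_mono) auto
  also have "\<dots> \<le> 1" using r by (simp add: power_le_one flip: power_add power_Suc)
  finally have small: "8 * C n * \<delta> * r ^ n \<le> 1" .
  have "A * (r / b) ^ N \<le> A * (r / b) ^ n"
    using n \<open>0 < A\<close> \<open>1 < r / b\<close> by (intro mult_left_mono power_increasing) auto
  also have "\<dots> = A / b ^ n * r ^ n" by (simp add: power_divide)
  also have "\<dots> \<le> (B / r ^ n + 8 * C n * \<delta>) * r ^ n"
    using est' r by (intro mult_right_mono) auto
  also have "\<dots> \<le> B + 1" using small r by (simp add: distrib_right)
  finally have "(r / b) ^ N \<le> (B + 1) / A" using \<open>0 < A\<close> by (simp add: field_simps)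
  \<comment> \<open>The hypotheses are contradictory, so the conclusion holds.\<close>
  with N have False by simp
  then show ?thesis ..
qed

end
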